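(* Let $\varepsilon,\bar\varepsilon\in\{1,-1\}$ and let $N_4=\mathbb R^4$ be the simply connected 2-step nilpotent Lie group described in the context, with its left-invariant metric. For real constants $C_2,C_3$ let $\Phi_t$ be the one-parameter group of isometries of $N_4$ fixing the identity that is the flow of the Killing field $$X=-\Big(\tfrac{\bar\varepsilon C_2}{2}x^2+C_3x\Big)\frac{\partial}{\partial y}-\Big(\tfrac{\bar\varepsilon C_2}{3}x^3+\tfrac{C_3}{2}x^2+\varepsilon C_2x\Big)\frac{\partial}{\partial z}+\big(\bar\varepsilon C_3y+C_2z\big)\frac{\partial}{\partial w}.$$ Then $\{\Phi_t\}_{t\in\mathbb R}\subseteq I^{spl}(N_4)$ if and only if $C_2=C_3=0$, and $\{\Phi_t\}_{t\in\mathbb R}\subseteq I^{aut}(N_4)$ if and only if $C_2=0$. Thus $I^{spl}(N_4)<I^{aut}(N_4)<I(N_4)$ (proper subgroups).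
   Context: $N_4$ is the group of real matrices with coordinates $(x,y,z,w)$ $$\begin{bmatrix}1&x&z&0&0\\0&1&y&0&0\\0&0&1&0&0\\0&0&0&1&w\\0&0&0&0&1\end{bmatrix},$$ with left-invariant frame $v=\partial_x$, $e=\partial_y+x\,\partial_z$, $z=\partial_z$, $u=\partial_w$ (the letter $z$ denotes both a coordinate and a vector field). The only nontrivial bracket is $[v,e]=z$; the center of the Lie algebra $\mathfrak n_4$ is $\mathfrak z=\operatorname{span}\{z,u\}$. The left-invariant metric has as its only nonzero inner products $\langle v,u\rangle=1$, $\langle e,e\rangle=\bar\varepsilon$, $\langle z,z\rangle=\varepsilon$. Put $\mathfrak v=\operatorname{span}\{v,e\}$, and let $TN_4=\mathfrak zN_4\oplus\mathfrak vN_4$ be the induced left-invariant splitting of the tangent bundle. $I(N_4)$ is the isometry group; $I^{spl}(N_4)$ is the subgroup of isometries whose differentials preserve this splitting; $O(N_4)=\operatorname{Aut}(N_4)\cap I(N_4)$; $I^{aut}(N_4)=O(N_4)\ltimes N_4$, with $N_4$ acting by left translations. *)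

theory Defs
  imports "HOL-Analysis.Analysis" "HOL-Algebra.Group"
begin

section \<open>The group\<close>

text \<open>The coordinates \<open>(x, y, z, w)\<close> of a point \<open>p\<close> are \<open>(p$1, p$2, p$3, p$4)\<close>.\<close>

definition N4_mat :: "real^4 \<Rightarrow> real^5^5" where
  "N4_mat p = (\<chi> i j.
     if i = j then 1
     else if i = 1 \<and> j = 2 then p$1
     else if i = 1 \<and> j = 3 then p$3
     else if i = 2 \<and> j = 3 then p$2
     else if i = 4 \<and> j = 5 then p$4
     else 0)"

text \<open>Matrix multiplication read off in the coordinates, see \<open>N4_mat_mult\<close> below.\<close>

definition N4_mult :: "real^4 \<Rightarrow> real^4 \<Rightarrow> real^4" where
  "N4_mult p q = vector [p$1 + q$1, p$2 + q$2, p$3 + q$3 + p$1 * q$2, p$4 + q$4]"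

definition N4 :: "(real^4) monoid" where
  "N4 = \<lparr>carrier = UNIV, mult = N4_mult, one = 0\<rparr>"

section \<open>Frame, splitting and metric\<close>

text \<open>Each tangent space is identified with \<open>real^4\<close> through the coordinate basis
  \<open>\<partial>\<^sub>x = axis 1 1\<close>, \<open>\<partial>\<^sub>y = axis 2 1\<close>, \<open>\<partial>\<^sub>z = axis 3 1\<close>, \<open>\<partial>\<^sub>w = axis 4 1\<close>; the differential of \<open>f\<close>
  at \<open>p\<close> is \<open>frechet_derivative f (at p)\<close>.\<close>

definition frame_v :: "real^4 \<Rightarrow> real^4" where "frame_v p = axis 1 1"
definition frame_e :: "real^4 \<Rightarrow> real^4" where "frame_e p = axis 2 1 + p$1 *\<^sub>R axis 3 1"
definition frame_z :: "real^4 \<Rightarrow> real^4" where "frame_z p = axis 3 1"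
definition frame_u :: "real^4 \<Rightarrow> real^4" where "frame_u p = axis 4 1"

definition zN :: "real^4 \<Rightarrow> (real^4) set" where "zN p = span {frame_z p, frame_u p}"
definition vN :: "real^4 \<Rightarrow> (real^4) set" where "vN p = span {frame_v p, frame_e p}"

text \<open>Coefficients of a tangent vector at \<open>p\<close> in the frame \<open>v, e, z, u\<close>, see
  \<open>frame_coords\<close> below.\<close>

definition frame_coords :: "real^4 \<Rightarrow> real^4 \<Rightarrow> real^4" where
  "frame_coords p a = vector [a$1, a$2, a$3 - p$1 * a$2, a$4]"

definition metric :: "real \<Rightarrow> real \<Rightarrow> real^4 \<Rightarrow> real^4 \<Rightarrow> real^4 \<Rightarrow> real" where
  "metric eps epsbar p a b =
     (let \<alpha> = frame_coords p a; \<beta> = frame_coords p b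
      in \<alpha>$1 * \<beta>$4 + \<alpha>$4 * \<beta>$1 + epsbar * (\<alpha>$2 * \<beta>$2) + eps * (\<alpha>$3 * \<beta>$3))"

section \<open>Isometries\<close>

primrec Ck_map :: "nat \<Rightarrow> (real^4 \<Rightarrow> real^4) \<Rightarrow> bool" where
  "Ck_map 0 = (\<lambda>f. continuous_on UNIV f)"
| "Ck_map (Suc k) = (\<lambda>f. (\<forall>p. f differentiable (at p)) \<and>
     (\<forall>a. Ck_map k (\<lambda>p. frechet_derivative f (at p) a)))"

definition smooth_map :: "(real^4 \<Rightarrow> real^4) \<Rightarrow> bool" where
  "smooth_map f \<longleftrightarrow> (\<forall>k. Ck_map k f)"

definition diffeo :: "(real^4 \<Rightarrow> real^4) \<Rightarrow> bool" where
  "diffeo f \<longleftrightarrow> bij f \<and> smooth_map f \<and> smooth_map (inv_into UNIV f)"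

definition isometries :: "real \<Rightarrow> real \<Rightarrow> (real^4 \<Rightarrow> real^4) set" where
  "isometries eps epsbar = {f. diffeo f \<and>
     (\<forall>p a b. metric eps epsbar (f p)
                (frechet_derivative f (at p) a) (frechet_derivative f (at p) b)
              = metric eps epsbar p a b)}"

definition isometry_group :: "real \<Rightarrow> real \<Rightarrow> (real^4 \<Rightarrow> real^4) monoid" where
  "isometry_group eps epsbar = \<lparr>carrier = isometries eps epsbar, mult = (\<circ>), one = id\<rparr>"

definition I_spl :: "real \<Rightarrow> real \<Rightarrow> (real^4 \<Rightarrow> real^4) set" where
  "I_spl eps epsbar = {f \<in> isometries eps epsbar.
     \<forall>p. frechet_derivative f (at p) ` zN p = zN (f p) \<and>
         frechet_derivative f (at p) ` vN p = vN (f p)}"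

definition Aut_N4 :: "(real^4 \<Rightarrow> real^4) set" where
  "Aut_N4 = {f \<in> iso N4 N4. diffeo f}"

definition O_N4 :: "real \<Rightarrow> real \<Rightarrow> (real^4 \<Rightarrow> real^4) set" where
  "O_N4 eps epsbar = Aut_N4 \<inter> isometries eps epsbar"

text \<open>The semidirect product \<open>O(N\<^sub>4) \<ltimes> N\<^sub>4\<close>, realised as the set of products of left translations
  with elements of \<open>O(N\<^sub>4)\<close>.\<close>

definition I_aut :: "real \<Rightarrow> real \<Rightarrow> (real^4 \<Rightarrow> real^4) set" where
  "I_aut eps epsbar = {N4_mult n \<circ> f | n f. f \<in> O_N4 eps epsbar}"

section \<open>The vector field and its flow\<close>

definition killing_field :: "real \<Rightarrow> real \<Rightarrow> real \<Rightarrow> real \<Rightarrow> real^4 \<Rightarrow> real^4" where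
  "killing_field eps epsbar C2 C3 p =
     - (epsbar * C2 / 2 * (p$1)^2 + C3 * p$1) *\<^sub>R axis 2 1
     - (epsbar * C2 / 3 * (p$1)^3 + C3 / 2 * (p$1)^2 + eps * C2 * p$1) *\<^sub>R axis 3 1
     + (epsbar * C3 * p$2 + C2 * p$3) *\<^sub>R axis 4 1"

definition is_flow :: "(real^4 \<Rightarrow> real^4) \<Rightarrow> (real \<Rightarrow> real^4 \<Rightarrow> real^4) \<Rightarrow> bool" where
  "is_flow X \<Phi> \<longleftrightarrow> (\<forall>p. \<Phi> 0 p = p) \<and>
     (\<forall>p t. ((\<lambda>s. \<Phi> s p) has_vector_derivative X (\<Phi> t p)) (at t))"

section \<open>Consistency of the coordinate formulas\<close>

lemma vec4_nth [simp]:
  "(vector [a, b, c, d] :: real^4) $ 1 = a"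
  "(vector [a, b, c, d] :: real^4) $ 2 = b"
  "(vector [a, b, c, d] :: real^4) $ 3 = c"
  "(vector [a, b, c, d] :: real^4) $ 4 = d"
  unfolding vector_def by auto

lemma axis4_nth [simp]:
  "(axis i c :: real^4) $ j = (if j = i then c else 0)"
  by (simp add: axis_def)

lemma exhaust_5:
  fixes i :: 5
  shows "i = 1 \<or> i = 2 \<or> i = 3 \<or> i = 4 \<or> i = 5"
proof (induct i)
  case (of_int z)
  then have "0 \<le> z" "z < 5" by simp_all
  then have "z = 0 \<or> z = 1 \<or> z = 2 \<or> z = 3 \<or> z = 4" by arith
  then show ?case by auto
qed

lemma UNIV_5: "(UNIV :: 5 set) = {1, 2, 3, 4, 5}"
  using exhaust_5 by auto

lemma forall_5: "(\<forall>i::5. P i) \<longleftrightarrow> P 1 \<and> P 2 \<and> P 3 \<and> P 4 \<and> P 5"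
  by (metis exhaust_5)

lemma sum_5: "sum f (UNIV :: 5 set) = f 1 + f 2 + f 3 + f 4 + f 5"
  unfolding UNIV_5 by (simp add: ac_simps)

lemma N4_mat_mult: "N4_mat (N4_mult p q) = N4_mat p ** N4_mat q"
proof -
  have "N4_mat (N4_mult p q) $ i $ j = (\<Sum>k\<in>UNIV. N4_mat p $ i $ k * N4_mat q $ k $ j)" for i j
    unfolding sum_5 using exhaust_5[of i] exhaust_5[of j]
    by (elim disjE) (simp_all add: N4_mat_def N4_mult_def)
  then show ?thesis
    by (simp add: vec_eq_iff matrix_matrix_mult_def)
qed

lemma N4_mat_one: "N4_mat 0 = mat 1"
  by (simp add: vec_eq_iff forall_5 N4_mat_def mat_def)

lemma inj_N4_mat: "inj N4_mat"
proof (rule injI)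
  fix p q :: "real^4"
  assume "N4_mat p = N4_mat q"
  then have "\<And>i j. N4_mat p $ i $ j = N4_mat q $ i $ j" by simp
  from this[of 1 2] this[of 1 3] this[of 2 3] this[of 4 5] show "p = q"
    by (simp add: N4_mat_def vec_eq_iff forall_4)
qed

lemma N4_mult_has_derivative:
  "(N4_mult n has_derivative (\<lambda>a. vector [a$1, a$2, a$3 + n$1 * a$2, a$4])) (at p)"
    (is "(_ has_derivative ?L) _")
proof -
  have "linear ?L"
    by (rule linearI) (simp_all add: vec_eq_iff forall_4 algebra_simps)
  then have "(?L has_derivative ?L) (at p)"
    by (simp add: bounded_linear_imp_has_derivative linear_conv_bounded_linear)
  then have "((\<lambda>q. n + ?L q) has_derivative ?L) (at p)"
    using has_derivative_add[OF has_derivative_const[of n "at p"]] by fastforce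
  moreover have "N4_mult n = (\<lambda>q. n + ?L q)"
    by (simp add: fun_eq_iff vec_eq_iff forall_4 N4_mult_def)
  ultimately show ?thesis by simp
qed

lemma N4_mult_differential:
  "frechet_derivative (N4_mult n) (at p) a = vector [a$1, a$2, a$3 + n$1 * a$2, a$4]"
  by (rule fun_cong[OF frechet_derivative_at[OF N4_mult_has_derivative, symmetric]])

lemma frame_left_invariant:
  "frechet_derivative (N4_mult n) (at p) (frame_v p) = frame_v (N4_mult n p)"
  "frechet_derivative (N4_mult n) (at p) (frame_e p) = frame_e (N4_mult n p)"
  "frechet_derivative (N4_mult n) (at p) (frame_z p) = frame_z (N4_mult n p)"
  "frechet_derivative (N4_mult n) (at p) (frame_u p) = frame_u (N4_mult n p)"
  by (simp_all add: N4_mult_differential vec_eq_iff forall_4 frame_v_def frame_e_def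
      frame_z_def frame_u_def N4_mult_def)

definition lie_bracket ::
  "(real^4 \<Rightarrow> real^4) \<Rightarrow> (real^4 \<Rightarrow> real^4) \<Rightarrow> real^4 \<Rightarrow> real^4" where
  "lie_bracket X Y p = frechet_derivative Y (at p) (X p) - frechet_derivative X (at p) (Y p)"

lemma frame_differential:
  "frechet_derivative frame_v (at p) a = 0"
  "frechet_derivative frame_e (at p) a = a$1 *\<^sub>R axis 3 1"
  "frechet_derivative frame_z (at p) a = 0"
  "frechet_derivative frame_u (at p) a = 0"
proof -
  have "(frame_e has_derivative (\<lambda>a. 0 + a$1 *\<^sub>R axis 3 1)) (at p)"
    unfolding frame_e_def[abs_def]
    by (intro has_derivative_add has_derivative_const has_derivative_scaleR_left
        bounded_linear_imp_has_derivative bounded_linear_vec_nth)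
  from fun_cong[OF frechet_derivative_at[OF this, symmetric]]
  show "frechet_derivative frame_e (at p) a = a$1 *\<^sub>R axis 3 1" by simp
qed (simp_all add: frame_v_def[abs_def] frame_z_def[abs_def] frame_u_def[abs_def])

lemma frame_brackets:
  "lie_bracket frame_v frame_e = frame_z"
  "lie_bracket frame_v frame_z = (\<lambda>_. 0)"
  "lie_bracket frame_v frame_u = (\<lambda>_. 0)"
  "lie_bracket frame_e frame_z = (\<lambda>_. 0)"
  "lie_bracket frame_e frame_u = (\<lambda>_. 0)"
  "lie_bracket frame_z frame_u = (\<lambda>_. 0)"
  unfolding lie_bracket_def[abs_def] frame_differential
  by (simp_all add: fun_eq_iff frame_v_def frame_e_def frame_z_def frame_u_def)

lemma frame_coords:
  "a = frame_coords p a $ 1 *\<^sub>R frame_v p + frame_coords p a $ 2 *\<^sub>R frame_e p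
     + frame_coords p a $ 3 *\<^sub>R frame_z p + frame_coords p a $ 4 *\<^sub>R frame_u p"
  by (simp add: vec_eq_iff forall_4 frame_v_def frame_e_def frame_z_def frame_u_def
      frame_coords_def algebra_simps)

lemma metric_frame:
  "metric eps epsbar p (frame_v p) (frame_u p) = 1"
  "metric eps epsbar p (frame_e p) (frame_e p) = epsbar"
  "metric eps epsbar p (frame_z p) (frame_z p) = eps"
  "metric eps epsbar p (frame_v p) (frame_v p) = 0"
  "metric eps epsbar p (frame_v p) (frame_e p) = 0"
  "metric eps epsbar p (frame_v p) (frame_z p) = 0"
  "metric eps epsbar p (frame_e p) (frame_z p) = 0"
  "metric eps epsbar p (frame_e p) (frame_u p) = 0"
  "metric eps epsbar p (frame_z p) (frame_u p) = 0"
  "metric eps epsbar p (frame_u p) (frame_u p) = 0"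
  by (simp_all add: metric_def frame_coords_def frame_v_def frame_e_def frame_z_def frame_u_def)

lemma metric_commute: "metric eps epsbar p a b = metric eps epsbar p b a"
  unfolding metric_def Let_def by (simp only: mult.commute add.commute)

lemma metric_left_invariant:
  "metric eps epsbar (N4_mult n p) (frechet_derivative (N4_mult n) (at p) a)
     (frechet_derivative (N4_mult n) (at p) b) = metric eps epsbar p a b"
proof -
  have "frame_coords (N4_mult n p) (frechet_derivative (N4_mult n) (at p) a) = frame_coords p a" for a
    by (simp add: N4_mult_differential vec_eq_iff forall_4 frame_coords_def N4_mult_def
        distrib_right)
  then show ?thesis by (simp add: metric_def)
qed

lemma killing_field_nth:
  "killing_field eps epsbar C2 C3 p $ 1 = 0"
  "killing_field eps epsbar C2 C3 p $ 2 = - (epsbar * C2 / 2 * (p$1)^2 + C3 * p$1)"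
  "killing_field eps epsbar C2 C3 p $ 3 =
     - (epsbar * C2 / 3 * (p$1)^3 + C3 / 2 * (p$1)^2 + eps * C2 * p$1)"
  "killing_field eps epsbar C2 C3 p $ 4 = epsbar * C3 * p$2 + C2 * p$3"
  by (simp_all add: killing_field_def)

lemma has_vector_derivative_vec4_iff:
  fixes f :: "real \<Rightarrow> real^4"
  shows "(f has_vector_derivative D) (at t) \<longleftrightarrow>
     (\<forall>i. ((\<lambda>s. f s $ i) has_real_derivative D $ i) (at t))"
proof
  assume "(f has_vector_derivative D) (at t)"
  then show "\<forall>i. ((\<lambda>s. f s $ i) has_real_derivative D $ i) (at t)"
    by (auto simp: has_real_derivative_iff_has_vector_derivative
        intro: bounded_linear.has_vector_derivative[OF bounded_linear_vec_nth])
next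
  assume *: "\<forall>i. ((\<lambda>s. f s $ i) has_real_derivative D $ i) (at t)"
  have "((\<lambda>s. \<Sum>i\<in>UNIV. (f s $ i) *\<^sub>R axis i 1) has_vector_derivative
      (\<Sum>i\<in>UNIV. (D $ i) *\<^sub>R axis i (1::real))) (at t)"
    using * by (intro has_vector_derivative_sum)
      (auto intro!: derivative_eq_intros)
  moreover have "(\<Sum>i\<in>UNIV. (w $ i) *\<^sub>R axis i (1::real)) = w" for w :: "real^4"
    by (simp add: vec_eq_iff forall_4 sum_4)
  ultimately show "(f has_vector_derivative D) (at t)" by simp
qed

lemma killing_field_flow_ex1: "\<exists>!\<Phi>. is_flow (killing_field eps epsbar C2 C3) \<Phi>"
proof -
  let ?X = "killing_field eps epsbar C2 C3"
  define a where "a x = - (epsbar * C2 / 2 * x^2 + C3 * x)" for x :: real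
  define b where "b x = - (epsbar * C2 / 3 * x^3 + C3 / 2 * x^2 + eps * C2 * x)" for x :: real
  define F :: "real \<Rightarrow> real^4 \<Rightarrow> real^4" where
    "F t p = vector [p$1, p$2 + t * a (p$1), p$3 + t * b (p$1),
       p$4 + t * (epsbar * C3 * p$2 + C2 * p$3)
         + t^2 / 2 * (epsbar * C3 * a (p$1) + C2 * b (p$1))]" for t p
  have X: "?X p $ 1 = 0" "?X p $ 2 = a (p$1)" "?X p $ 3 = b (p$1)"
      "?X p $ 4 = epsbar * C3 * p$2 + C2 * p$3" for p
    by (simp_all add: killing_field_nth a_def b_def)
  have zero: "f t = f 0" if "\<And>t. (f has_real_derivative 0) (at t)" for f :: "real \<Rightarrow> real" and t
    using DERIV_const_ratio_const2[of t 0 f 0] that by (cases "t = 0") auto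
  have "is_flow ?X F"
    unfolding is_flow_def has_vector_derivative_vec4_iff forall_4 X
    by (auto simp: F_def vec_eq_iff forall_4 algebra_simps intro!: derivative_eq_intros)
  moreover have "\<Phi> = F" if "is_flow ?X \<Phi>" for \<Phi>
  proof (intro ext)
    fix t p
    have init: "\<Phi> 0 p = p" using that by (simp add: is_flow_def)
    have d: "((\<lambda>s. \<Phi> s p $ i) has_real_derivative ?X (\<Phi> t p) $ i) (at t)" for i t
      using that by (simp add: is_flow_def has_vector_derivative_vec4_iff)
    have 1: "\<Phi> t p $ 1 = p $ 1" for t
      using zero[of "\<lambda>s. \<Phi> s p $ 1" t] d[of 1] by (simp add: X init)
    have "((\<lambda>s. \<Phi> s p $ 2 - s * a (p$1)) has_real_derivative 0) (at t)" for t
      using d[of 2 t] by (auto simp: X 1 intro!: derivative_eq_intros)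
    from zero[OF this] have 2: "\<Phi> t p $ 2 = p $ 2 + t * a (p$1)" for t
      using init by (simp add: algebra_simps)
    have "((\<lambda>s. \<Phi> s p $ 3 - s * b (p$1)) has_real_derivative 0) (at t)" for t
      using d[of 3 t] by (auto simp: X 1 intro!: derivative_eq_intros)
    from zero[OF this] have 3: "\<Phi> t p $ 3 = p $ 3 + t * b (p$1)" for t
      using init by (simp add: algebra_simps)
    have "((\<lambda>s. \<Phi> s p $ 4 - (s * (epsbar * C3 * p$2 + C2 * p$3)
         + s^2 / 2 * (epsbar * C3 * a (p$1) + C2 * b (p$1)))) has_real_derivative 0) (at t)" for t
      using d[of 4 t] by (auto simp: X 2 3 algebra_simps intro!: derivative_eq_intros)
    from zero[OF this] have 4: "\<Phi> t p $ 4 = p $ 4 + (t * (epsbar * C3 * p$2 + C2 * p$3)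
         + t^2 / 2 * (epsbar * C3 * a (p$1) + C2 * b (p$1)))" for t
      using init by (simp add: algebra_simps)
    show "\<Phi> t p = F t p"
      by (simp add: vec_eq_iff forall_4 F_def 1 2 3 4)
  qed
  ultimately show ?thesis by blast
qed

end

theory Submission
  imports Defs
begin

text \<open>A splitting-preserving isometry has a diagonal differential in the frame, and integrating this shows
  that it is a left translation after one of four diagonal automorphisms. Hence
  \<open>I\<^sup>s\<^sup>p\<^sup>l \<subseteq> I\<^sup>a\<^sup>u\<^sup>t\<close>, and these maps leave no room for the \<open>y\<close>- and \<open>z\<close>-dependence of the \<open>w\<close>-component
  of the flow unless \<open>C\<^sub>2 = C\<^sub>3 = 0\<close>. The flow fixes the identity, so it lies in \<open>I\<^sup>a\<^sup>u\<^sup>t\<close> iff it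
  consists of homomorphisms, which the quadratic \<open>y\<close>-component rules out unless \<open>C\<^sub>2 = 0\<close>.\<close>

section \<open>Maps of class \<open>C\<^sup>k\<close>\<close>

text \<open>The product and chain rules leave some factors undifferentiated, so their inductions
  must lower the order of those factors by one.\<close>

lemma Ck_map_Suc_imp: "Ck_map (Suc k) f \<Longrightarrow> Ck_map k f"
proof (induction k arbitrary: f)
  case 0
  then show ?case
    by (simp add: continuous_at_imp_continuous_on differentiable_imp_continuous_within)
next
  case (Suc k)
  have "Ck_map k (\<lambda>p. frechet_derivative f (at p) a)" for a
    using Suc.IH[of "\<lambda>p. frechet_derivative f (at p) a"] Suc.prems by simp
  then show ?case using Suc.prems by simp
qed

lemma Ck_map_const: "Ck_map k (\<lambda>p. c)"
  by (induction k arbitrary: c) simp_all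

lemma Ck_map_linear:
  assumes "bounded_linear f" shows "Ck_map k f"
proof (cases k)
  case 0
  then show ?thesis using assms by (simp add: linear_continuous_on)
next
  case (Suc k')
  have *: "(f has_derivative f) (at p)" for p
    using assms by (rule bounded_linear_imp_has_derivative)
  then have "frechet_derivative f (at p) = f" for p
    using frechet_derivative_at by metis
  then show ?thesis using * Suc by (auto simp: differentiable_def Ck_map_const)
qed

lemma Ck_map_add:
  "Ck_map k f \<Longrightarrow> Ck_map k g \<Longrightarrow> Ck_map k (\<lambda>p. f p + g p)"
proof (induction k arbitrary: f g)
  case 0
  then show ?case by (simp add: continuous_on_add)
next
  case (Suc k)
  have "((\<lambda>p. f p + g p) has_derivative
      (\<lambda>a. frechet_derivative f (at p) a + frechet_derivative g (at p) a)) (at p)" for p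
    using Suc.prems by (intro has_derivative_add) (simp_all flip: frechet_derivative_works)
  from frechet_derivative_at[OF this, symmetric] this
  show ?case using Suc by (auto simp: differentiable_def)
qed

lemma Ck_map_sum:
  "finite I \<Longrightarrow> (\<And>i. i \<in> I \<Longrightarrow> Ck_map k (f i)) \<Longrightarrow> Ck_map k (\<lambda>p. \<Sum>i\<in>I. f i p)"
  by (induction I rule: finite_induct) (auto intro: Ck_map_const Ck_map_add)

text \<open>\<open>Ck_map\<close> speaks only of maps into \<open>real^4\<close>, so a scalar factor
  has to enter as a component of such a map.\<close>

lemma Ck_map_scaleR:
  "Ck_map k f \<Longrightarrow> Ck_map k g \<Longrightarrow> Ck_map k (\<lambda>p. f p $ i *\<^sub>R g p)"
proof (induction k arbitrary: f g)
  case 0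
  then show ?case by (auto intro!: continuous_intros)
next
  case (Suc k)
  have "((\<lambda>p. f p $ i *\<^sub>R g p) has_derivative
      (\<lambda>a. f p $ i *\<^sub>R frechet_derivative g (at p) a + frechet_derivative f (at p) a $ i *\<^sub>R g p)) (at p)" for p
    using Suc.prems
    by (intro has_derivative_scaleR bounded_linear.has_derivative[OF bounded_linear_vec_nth])
      (simp_all flip: frechet_derivative_works)
  from frechet_derivative_at[OF this, symmetric] this
  show ?case
    using Suc Ck_map_Suc_imp[OF Suc.prems(1)] Ck_map_Suc_imp[OF Suc.prems(2)]
    by (auto simp: differentiable_def intro!: Ck_map_add)
qed

lemma Ck_map_cmult:
  assumes "Ck_map k f" shows "Ck_map k (\<lambda>p. c *\<^sub>R f p)"
  \<comment> \<open>The scalar \<open>c\<close> is the first component of the constant map with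
    value \<open>axis 1 c\<close>.\<close>
  using Ck_map_scaleR[OF Ck_map_const[of k "axis 1 c"] assms, of 1] by simp

lemma linear_axis_sum:
  fixes L :: "real^4 \<Rightarrow> real^4"
  assumes "linear L" shows "L a = (\<Sum>i\<in>UNIV. a $ i *\<^sub>R L (axis i 1))"
proof -
  have "a = (\<Sum>i\<in>UNIV. a $ i *\<^sub>R axis i 1)"
    by (simp add: vec_eq_iff forall_4 sum_4)
  then have "L a = L (\<Sum>i\<in>UNIV. a $ i *\<^sub>R axis i 1)" by simp
  then show ?thesis using assms by (simp add: linear_sum linear_cmul)
qed

text \<open>The derivative applies \<open>?Df (g p)\<close> to a vector varying with
  \<open>p\<close>, while \<open>Ck_map\<close> controls derivatives in fixed directions only.
  Expanding that vector in the standard basis gives a sum of products to which the induction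
  hypothesis applies.\<close>

lemma Ck_map_compose:
  "Ck_map k f \<Longrightarrow> Ck_map k g \<Longrightarrow> Ck_map k (\<lambda>p. f (g p))"
proof (induction k arbitrary: f g)
  case 0
  then show ?case
    using continuous_on_compose2[of UNIV f UNIV g] by simp
next
  case (Suc k)
  let ?Df = "\<lambda>p. frechet_derivative f (at p)" and ?Dg = "\<lambda>p. frechet_derivative g (at p)"
  have d: "((\<lambda>p. f (g p)) has_derivative (\<lambda>a. ?Df (g p) (?Dg p a))) (at p)" for p
    using Suc.prems by (intro has_derivative_compose[of g _ p UNIV f])
      (simp_all flip: frechet_derivative_works)
  have "linear (?Df p)" for p
    using Suc.prems(1) by (simp add: linear_frechet_derivative)
  then have "?Df (g p) (?Dg p a) = (\<Sum>i\<in>UNIV. ?Dg p a $ i *\<^sub>R ?Df (g p) (axis i 1))" for p a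
    by (rule linear_axis_sum)
  with frechet_derivative_at[OF d, symmetric]
  have "frechet_derivative (\<lambda>p. f (g p)) (at p) a
      = (\<Sum>i\<in>UNIV. ?Dg p a $ i *\<^sub>R ?Df (g p) (axis i 1))" for p a by simp
  moreover have "Ck_map k (\<lambda>p. \<Sum>i\<in>UNIV. ?Dg p a $ i *\<^sub>R ?Df (g p) (axis i 1))" for a
  proof (rule Ck_map_sum)
    show "Ck_map k (\<lambda>p. ?Dg p a $ i *\<^sub>R ?Df (g p) (axis i 1))" for i
      by (rule Ck_map_scaleR[OF _ Suc.IH[of "\<lambda>q. ?Df q (axis i 1)", OF _ Ck_map_Suc_imp[OF Suc.prems(2)]]])
        (use Suc.prems in simp_all)
  qed simp
  moreover have "(\<lambda>p. f (g p)) differentiable (at p)" for p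
    using d unfolding differentiable_def by blast
  ultimately show ?case by simp
qed

lemma smooth_map_comp: "smooth_map f \<Longrightarrow> smooth_map g \<Longrightarrow> smooth_map (f \<circ> g)"
  by (simp add: smooth_map_def Ck_map_compose comp_def)

lemma smooth_map_has_derivative:
  assumes "smooth_map f"
  shows "(f has_derivative frechet_derivative f (at p)) (at p)"
proof -
  have "Ck_map (Suc 0) f" using assms unfolding smooth_map_def by blast
  then show ?thesis by (simp flip: frechet_derivative_works)
qed

lemma frechet_derivative_smooth_comp:
  assumes "smooth_map f" "smooth_map g"
  shows "frechet_derivative (f \<circ> g) (at p) a
    = frechet_derivative f (at (g p)) (frechet_derivative g (at p) a)"
  using frechet_derivative_at[OF diff_chain_at[OF smooth_map_has_derivative[OF assms(2)]
        smooth_map_has_derivative[OF assms(1)]], THEN fun_cong, of p a]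
  by simp

section \<open>The isometry group\<close>

lemma diffeoI:
  assumes "smooth_map f" "smooth_map g" "f \<circ> g = id" "g \<circ> f = id"
  shows "diffeo f"
  using assms o_bij[of g f] inv_unique_comp[of f g] by (simp add: diffeo_def)

lemma diffeo_comp: "diffeo f \<Longrightarrow> diffeo g \<Longrightarrow> diffeo (f \<circ> g)"
  by (simp add: diffeo_def bij_comp smooth_map_comp o_inv_distrib)

lemma diffeo_inv: "diffeo f \<Longrightarrow> diffeo (inv_into UNIV f)"
  by (simp add: diffeo_def bij_imp_bij_inv inv_inv_eq)

lemma frechet_derivative_inv:
  assumes "diffeo f"
  shows "frechet_derivative f (at (inv_into UNIV f p)) (frechet_derivative (inv_into UNIV f) (at p) a) = a"
    and "frechet_derivative (inv_into UNIV f) (at p) (frechet_derivative f (at (inv_into UNIV f p)) a) = a"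
proof -
  have b: "bij f" "smooth_map f" "smooth_map (inv_into UNIV f)" using assms by (simp_all add: diffeo_def)
  have "f \<circ> inv_into UNIV f = id" "inv_into UNIV f \<circ> f = id"
    using b(1) by (simp_all add: bij_is_surj bij_is_inj surj_iff[symmetric])
  then show "frechet_derivative f (at (inv_into UNIV f p)) (frechet_derivative (inv_into UNIV f) (at p) a) = a"
    "frechet_derivative (inv_into UNIV f) (at p) (frechet_derivative f (at (inv_into UNIV f p)) a) = a"
    using frechet_derivative_smooth_comp[OF b(2,3), of p a]
      frechet_derivative_smooth_comp[OF b(3,2), of "inv_into UNIV f p" a] b(1)
    by (simp_all add: bij_is_surj surj_f_inv_f id_def)
qed

lemma id_isometry: "id \<in> isometries eps epsbar"
proof -
  have "smooth_map id"
    by (simp add: smooth_map_def Ck_map_linear id_def bounded_linear_ident)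
  then have "diffeo id" by (intro diffeoI[of id id]) simp_all
  then show ?thesis by (simp add: isometries_def id_def)
qed

lemma isometries_comp:
  assumes "f \<in> isometries eps epsbar" "g \<in> isometries eps epsbar"
  shows "f \<circ> g \<in> isometries eps epsbar"
  using assms by (simp add: isometries_def diffeo_comp)
    (simp add: diffeo_def frechet_derivative_smooth_comp)

lemma isometries_inv:
  assumes "f \<in> isometries eps epsbar"
  shows "inv_into UNIV f \<in> isometries eps epsbar"
proof -
  have d: "diffeo f" using assms by (simp add: isometries_def)
  have "metric eps epsbar (inv_into UNIV f p) (frechet_derivative (inv_into UNIV f) (at p) a)
      (frechet_derivative (inv_into UNIV f) (at p) b) = metric eps epsbar p a b" for p a b
  proof -
    have "f (inv_into UNIV f p) = p" using d by (simp add: diffeo_def bij_is_surj surj_f_inv_f)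
    moreover have "metric eps epsbar (inv_into UNIV f p) a' b' = metric eps epsbar (f (inv_into UNIV f p))
        (frechet_derivative f (at (inv_into UNIV f p)) a') (frechet_derivative f (at (inv_into UNIV f p)) b')" for a' b'
      using assms by (simp add: isometries_def)
    ultimately show ?thesis by (simp add: frechet_derivative_inv[OF d])
  qed
  then show ?thesis using d by (simp add: isometries_def diffeo_inv)
qed

lemma isometries_inv_comp: "f \<in> isometries eps epsbar \<Longrightarrow> inv_into UNIV f \<circ> f = id"
  by (simp add: isometries_def diffeo_def bij_is_inj)

lemma group_isometry_group: "group (isometry_group eps epsbar)"
proof (rule groupI)
  show "\<exists>y\<in>carrier (isometry_group eps epsbar).
      y \<otimes>\<^bsub>isometry_group eps epsbar\<^esub> f = \<one>\<^bsub>isometry_group eps epsbar\<^esub>"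
    if "f \<in> carrier (isometry_group eps epsbar)" for f
    using that isometries_inv[of f] isometries_inv_comp[of f]
    by (auto simp: isometry_group_def intro: bexI[of _ "inv_into UNIV f"])
qed (auto simp: isometry_group_def id_isometry isometries_comp comp_assoc)

text \<open>The inverse in the isometry group is the inverse function, so closure can be checked on
  plain functions.\<close>

lemma subgroup_isometry_groupI:
  assumes "H \<subseteq> isometries eps epsbar" "id \<in> H"
    and "\<And>f g. f \<in> H \<Longrightarrow> g \<in> H \<Longrightarrow> f \<circ> g \<in> H"
    and "\<And>f. f \<in> H \<Longrightarrow> inv_into UNIV f \<in> H"
  shows "subgroup H (isometry_group eps epsbar)"
proof -
  interpret group "isometry_group eps epsbar" by (rule group_isometry_group)
  have "inv\<^bsub>isometry_group eps epsbar\<^esub> f = inv_into UNIV f" if "f \<in> H" for f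
    using that assms(1) isometries_inv[of f] isometries_inv_comp[of f]
    by (intro inv_equality) (auto simp: isometry_group_def)
  then show ?thesis
    using assms by (intro subgroupI) (auto simp: isometry_group_def)
qed

lemma isometriesI:
  assumes "diffeo f" "\<And>p. (f has_derivative D p) (at p)"
    and "\<And>p a b. metric eps epsbar (f p) (D p a) (D p b) = metric eps epsbar p a b"
  shows "f \<in> isometries eps epsbar"
  using assms frechet_derivative_at[OF assms(2)] by (simp add: isometries_def)

section \<open>Isometries composed of left translations and automorphisms\<close>

lemma N4_mult_assoc: "N4_mult (N4_mult a b) c = N4_mult a (N4_mult b c)"
  by (simp add: N4_mult_def vec_eq_iff forall_4 algebra_simps)

lemma N4_mult_zero [simp]: "N4_mult 0 p = p" "N4_mult p 0 = p"
  by (simp_all add: N4_mult_def vec_eq_iff forall_4)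

text \<open>The third coordinate compensates the product \<open>n$1 * (- n$2)\<close> created by the
  group law.\<close>

definition N4_inv :: "real^4 \<Rightarrow> real^4" where
  "N4_inv n = vector [- n$1, - n$2, n$1 * n$2 - n$3, - n$4]"

lemma N4_mult_inv [simp]: "N4_mult n (N4_inv n) = 0" "N4_mult (N4_inv n) n = 0"
  by (simp_all add: N4_mult_def N4_inv_def vec_eq_iff forall_4)

text \<open>A left translation is affine in the coordinates: the constant \<open>n\<close> plus a
  linear map.\<close>

lemma smooth_N4_mult: "smooth_map (N4_mult n)"
proof -
  have "linear (\<lambda>a::real^4. vector [a$1, a$2, a$3 + n$1 * a$2, a$4] :: real^4)"
    by (rule linearI) (simp_all add: vec_eq_iff forall_4 algebra_simps)
  then have "Ck_map k (\<lambda>a. n + vector [a$1, a$2, a$3 + n$1 * a$2, a$4])" for k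
    by (intro Ck_map_add Ck_map_const Ck_map_linear) (simp add: linear_conv_bounded_linear)
  moreover have "N4_mult n = (\<lambda>a. n + vector [a$1, a$2, a$3 + n$1 * a$2, a$4])"
    by (simp add: fun_eq_iff vec_eq_iff forall_4 N4_mult_def)
  ultimately show ?thesis by (simp add: smooth_map_def)
qed

lemma N4_mult_isometry: "N4_mult n \<in> isometries eps epsbar"
proof -
  have "diffeo (N4_mult n)"
    by (rule diffeoI[of _ "N4_mult (N4_inv n)"])
      (simp_all add: smooth_N4_mult fun_eq_iff flip: N4_mult_assoc)
  then show ?thesis by (simp add: isometries_def metric_left_invariant)
qed

section \<open>Isometric automorphisms and their products with left translations\<close>

lemma O_N4_hom: "f \<in> O_N4 eps epsbar \<Longrightarrow> f (N4_mult p q) = N4_mult (f p) (f q)"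
  by (simp add: O_N4_def Aut_N4_def iso_def hom_def N4_def)

lemma O_N4_zero:
  assumes "f \<in> O_N4 eps epsbar" shows "f 0 = 0"
proof -
  have "N4_mult (f 0) (f 0) = f 0"
    using O_N4_hom[OF assms, of 0 0] by simp
  then have "N4_mult (N4_inv (f 0)) (N4_mult (f 0) (f 0)) = 0" by simp
  then show ?thesis by (simp flip: N4_mult_assoc)
qed

text \<open>Bijectivity and smoothness in both directions are already part of being an
  isometry.\<close>

lemma O_N4I:
  assumes "f \<in> isometries eps epsbar" "\<And>p q. f (N4_mult p q) = N4_mult (f p) (f q)"
  shows "f \<in> O_N4 eps epsbar"
  using assms by (simp add: O_N4_def Aut_N4_def iso_def hom_def N4_def isometries_def diffeo_def)

lemma O_N4_isometry: "f \<in> O_N4 eps epsbar \<Longrightarrow> f \<in> isometries eps epsbar"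
  by (simp add: O_N4_def)

lemma O_N4_bij: "f \<in> O_N4 eps epsbar \<Longrightarrow> bij f"
  by (simp add: O_N4_def isometries_def diffeo_def)

lemma O_N4_inv:
  assumes "f \<in> O_N4 eps epsbar" shows "inv_into UNIV f \<in> O_N4 eps epsbar"
proof (rule O_N4I)
  show "inv_into UNIV f \<in> isometries eps epsbar" using O_N4_isometry[OF assms] by (rule isometries_inv)
  have f: "bij f" using assms by (rule O_N4_bij)
  show "inv_into UNIV f (N4_mult p q) = N4_mult (inv_into UNIV f p) (inv_into UNIV f q)" for p q
  proof -
    have "f (N4_mult (inv_into UNIV f p) (inv_into UNIV f q)) = N4_mult p q"
      using f by (simp add: O_N4_hom[OF assms] bij_is_surj surj_f_inv_f)
    then show ?thesis using f by (metis bij_inv_eq_iff)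
  qed
qed

lemma O_N4_comp:
  assumes "f \<in> O_N4 eps epsbar" "g \<in> O_N4 eps epsbar" shows "f \<circ> g \<in> O_N4 eps epsbar"
  using assms by (intro O_N4I isometries_comp) (simp_all add: O_N4_isometry O_N4_hom)

lemma O_N4_subset_I_aut: "O_N4 eps epsbar \<subseteq> I_aut eps epsbar"
proof
  fix f assume "f \<in> O_N4 eps epsbar"
  moreover have "f = N4_mult 0 \<circ> f" by (simp add: fun_eq_iff)
  ultimately show "f \<in> I_aut eps epsbar" unfolding I_aut_def by blast
qed

text \<open>Automorphisms fix the identity, so the translation part of an element of
  \<open>I_aut\<close> is its value at \<open>0\<close>.\<close>

lemma I_aut_fixing_zero:
  assumes "f \<in> I_aut eps epsbar" "f 0 = 0" shows "f \<in> O_N4 eps epsbar"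
proof -
  obtain n g where g: "f = N4_mult n \<circ> g" "g \<in> O_N4 eps epsbar"
    using assms(1) by (auto simp: I_aut_def)
  then have "n = 0" using assms(2) O_N4_zero[OF g(2)] by simp
  then have "f = g" using g(1) by (simp add: fun_eq_iff)
  then show ?thesis using g(2) by simp
qed

lemma subgroup_I_aut: "subgroup (I_aut eps epsbar) (isometry_group eps epsbar)"
proof (rule subgroup_isometry_groupI)
  show "I_aut eps epsbar \<subseteq> isometries eps epsbar"
    by (auto simp: I_aut_def intro: isometries_comp N4_mult_isometry O_N4_isometry)
  have "id \<in> O_N4 eps epsbar" by (simp add: O_N4I id_isometry)
  then show "id \<in> I_aut eps epsbar" using O_N4_subset_I_aut by blast
next
  fix f' g' assume "f' \<in> I_aut eps epsbar" "g' \<in> I_aut eps epsbar"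
  then obtain n f m g where f: "f' = N4_mult n \<circ> f" "f \<in> O_N4 eps epsbar"
    and g: "g' = N4_mult m \<circ> g" "g \<in> O_N4 eps epsbar" by (auto simp: I_aut_def)
  \<comment> \<open>A homomorphism \<open>f\<close> moves past the translation by \<open>m\<close>
    by turning it into the translation by \<open>f m\<close>.\<close>
  have "f' \<circ> g' = N4_mult (N4_mult n (f m)) \<circ> (f \<circ> g)"
    by (simp add: f(1) g(1) fun_eq_iff O_N4_hom[OF f(2)] N4_mult_assoc)
  then show "f' \<circ> g' \<in> I_aut eps epsbar"
    using O_N4_comp[OF f(2) g(2)] unfolding I_aut_def by blast
next
  fix f' assume "f' \<in> I_aut eps epsbar"
  then obtain n f where f: "f' = N4_mult n \<circ> f" "f \<in> O_N4 eps epsbar" by (auto simp: I_aut_def)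
  have b: "f (inv_into UNIV f p) = p" "inv_into UNIV f (f p) = p" for p
    using O_N4_bij[OF f(2)] by (simp_all add: bij_is_surj surj_f_inv_f bij_is_inj)
  \<comment> \<open>The inverse of \<open>f'\<close> is the inverse of \<open>f\<close> after
    translation by \<open>N4_inv n\<close>; moving the translation to the left gives this
    form.\<close>
  let ?g = "N4_mult (inv_into UNIV f (N4_inv n)) \<circ> inv_into UNIV f"
  have "f' \<circ> ?g = id"
    by (simp add: f(1) fun_eq_iff O_N4_hom[OF f(2)] b flip: N4_mult_assoc)
  moreover have "?g \<circ> f' = id"
  proof (rule ext)
    fix p
    have "(?g \<circ> f') p = N4_mult (N4_mult (inv_into UNIV f (N4_inv n)) (inv_into UNIV f n)) p"
      by (simp add: f(1) O_N4_hom[OF O_N4_inv[OF f(2)]] b N4_mult_assoc)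
    also have "N4_mult (inv_into UNIV f (N4_inv n)) (inv_into UNIV f n) = inv_into UNIV f 0"
      by (simp flip: O_N4_hom[OF O_N4_inv[OF f(2)]])
    finally show "(?g \<circ> f') p = id p" by (simp add: O_N4_zero[OF O_N4_inv[OF f(2)]])
  qed
  ultimately have "inv_into UNIV f' = ?g" by (rule inv_unique_comp)
  then show "inv_into UNIV f' \<in> I_aut eps epsbar"
    using O_N4_inv[OF f(2)] unfolding I_aut_def by blast
qed

section \<open>Isometries preserving the splitting\<close>

lemma zN_eq: "zN p = {a. a$1 = 0 \<and> a$2 = 0}"
proof -
  have "a \<in> zN p" if "a$1 = 0" "a$2 = 0" for a
  proof -
    have "a = a$3 *\<^sub>R frame_z p + a$4 *\<^sub>R frame_u p"
      using that by (simp add: vec_eq_iff forall_4 frame_z_def frame_u_def)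
    then show ?thesis
      unfolding zN_def by (metis insertCI span_add span_base span_scale)
  qed
  moreover have "a$1 = 0 \<and> a$2 = 0" if "a \<in> zN p" for a
    using that unfolding zN_def
    by (induction rule: span_induct_alt) (auto simp: frame_z_def frame_u_def)
  ultimately show ?thesis by blast
qed

text \<open>The field \<open>frame_e\<close> tilts by \<open>p$1\<close> in the z-direction, so this
  subspace, unlike \<open>zN p\<close>, varies with the base point.\<close>

lemma vN_eq: "vN p = {a. a$3 = p$1 * a$2 \<and> a$4 = 0}"
proof -
  have "a \<in> vN p" if "a$3 = p$1 * a$2" "a$4 = 0" for a
  proof -
    have "a = a$1 *\<^sub>R frame_v p + a$2 *\<^sub>R frame_e p"
      using that by (simp add: vec_eq_iff forall_4 frame_v_def frame_e_def)
    then show ?thesis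
      unfolding vN_def by (metis insertCI span_add span_base span_scale)
  qed
  moreover have "a$3 = p$1 * a$2 \<and> a$4 = 0" if "a \<in> vN p" for a
    using that unfolding vN_def
    by (induction rule: span_induct_alt) (auto simp: frame_v_def frame_e_def algebra_simps)
  ultimately show ?thesis by blast
qed

lemma subgroup_I_spl: "subgroup (I_spl eps epsbar) (isometry_group eps epsbar)"
proof (rule subgroup_isometry_groupI)
  show "I_spl eps epsbar \<subseteq> isometries eps epsbar" by (auto simp: I_spl_def)
  show "id \<in> I_spl eps epsbar" using id_isometry by (simp add: I_spl_def id_def)
next
  fix f g assume f: "f \<in> I_spl eps epsbar" and g: "g \<in> I_spl eps epsbar"
  then have "frechet_derivative (f \<circ> g) (at p) ` A
      = frechet_derivative f (at (g p)) ` frechet_derivative g (at p) ` A" for p A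
    by (simp add: image_image frechet_derivative_smooth_comp I_spl_def isometries_def diffeo_def)
  then show "f \<circ> g \<in> I_spl eps epsbar"
    using f g by (simp add: I_spl_def isometries_comp)
next
  fix f assume f: "f \<in> I_spl eps epsbar"
  then have d: "diffeo f" by (simp add: I_spl_def isometries_def)
  have "f (inv_into UNIV f p) = p" for p using d by (simp add: diffeo_def bij_is_surj surj_f_inv_f)
  then have im: "frechet_derivative f (at (inv_into UNIV f p)) ` zN (inv_into UNIV f p) = zN p"
    "frechet_derivative f (at (inv_into UNIV f p)) ` vN (inv_into UNIV f p) = vN p" for p
    using f by (simp_all add: I_spl_def)
  have "frechet_derivative (inv_into UNIV f) (at p) ` zN p = zN (inv_into UNIV f p)"
    "frechet_derivative (inv_into UNIV f) (at p) ` vN p = vN (inv_into UNIV f p)" for p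
    \<comment> \<open>Once \<open>zN p\<close> and \<open>vN p\<close> are written as images under
      the differential of \<open>f\<close>, the differential of the inverse cancels it.\<close>
    by (simp_all add: image_image frechet_derivative_inv[OF d] flip: im[of p])
  then show "inv_into UNIV f \<in> I_spl eps epsbar"
    using f by (simp add: I_spl_def isometries_inv)
qed

text \<open>For signs \<open>s\<close> and \<open>t\<close> of y and z, the bracket
  \<open>[v,e] = z\<close> forces the sign \<open>s * t\<close> on x, and the pairing of v with u
  forces the same sign on w.\<close>

definition diag_map :: "real \<Rightarrow> real \<Rightarrow> real^4 \<Rightarrow> real^4" where
  "diag_map s t p = vector [s * t * p$1, s * p$2, t * p$3, s * t * p$4]"

lemma diag_map_O_N4:
  assumes "s^2 = 1" "t^2 = 1" shows "diag_map s t \<in> O_N4 eps epsbar"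
proof (rule O_N4I)
  have l: "bounded_linear (diag_map s t)"
    by (subst linear_conv_bounded_linear[symmetric], rule linearI)
      (simp_all add: diag_map_def vec_eq_iff forall_4 algebra_simps)
  have st: "s = 1 \<or> s = -1" "t = 1 \<or> t = -1" using assms by (simp_all add: power2_eq_1_iff)
  \<comment> \<open>Only signs occur, so the map is its own inverse.\<close>
  have "diag_map s t \<circ> diag_map s t = id"
    using st by (elim disjE) (simp_all add: fun_eq_iff diag_map_def vec_eq_iff forall_4)
  moreover have "smooth_map (diag_map s t)" using l by (simp add: smooth_map_def Ck_map_linear)
  ultimately have "diffeo (diag_map s t)" using diffeoI by blast
  then show "diag_map s t \<in> isometries eps epsbar"
  proof (rule isometriesI)
    show "(diag_map s t has_derivative diag_map s t) (at p)" for p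
      using l by (rule bounded_linear_imp_has_derivative)
    show "metric eps epsbar (diag_map s t p) (diag_map s t a) (diag_map s t b)
        = metric eps epsbar p a b" for p a b
      using st by (elim disjE) (simp_all add: metric_def frame_coords_def diag_map_def algebra_simps)
  qed
  show "diag_map s t (N4_mult p q) = N4_mult (diag_map s t p) (diag_map s t q)" for p q
    using st by (elim disjE) (simp_all add: diag_map_def N4_mult_def vec_eq_iff forall_4)
qed

section \<open>One-variable calculus along lines, and continuous sign functions\<close>

lemma DERIV_along_line:
  fixes f :: "real^4 \<Rightarrow> real"
  assumes "(f has_derivative f') (at (p + t *\<^sub>R h))"
  shows "((\<lambda>t. f (p + t *\<^sub>R h)) has_real_derivative f' h) (at t)"
proof -
  have "((\<lambda>t. p + t *\<^sub>R h) has_derivative (\<lambda>r. r *\<^sub>R h)) (at t)"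
    by (auto intro!: derivative_eq_intros)
  from has_derivative_compose[OF this assms]
  have "((\<lambda>t. f (p + t *\<^sub>R h)) has_derivative (\<lambda>r. f' (r *\<^sub>R h))) (at t)" .
  moreover have "(\<lambda>r. f' (r *\<^sub>R h)) = (*) (f' h)"
    using linear_cmul[OF has_derivative_linear[OF assms]] by (simp add: fun_eq_iff)
  ultimately show ?thesis by (simp add: has_field_derivative_def)
qed

text \<open>Restricted to the segment from \<open>p\<close> to \<open>p + h\<close>, the function
  has zero derivative. The displacement itself serves as the direction.\<close>

lemma constant_along_line:
  fixes f :: "real^4 \<Rightarrow> real"
  assumes "\<And>p. (f has_derivative f' p) (at p)" "\<And>p. f' p h = 0"
  shows "f (p + h) = f p"
proof -
  let ?g = "\<lambda>t. f (p + t *\<^sub>R h)"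
  have "(?g has_real_derivative 0) (at t)" for t
    using DERIV_along_line[OF assms(1)[of "p + t *\<^sub>R h"]] assms(2)[of "p + t *\<^sub>R h"] by simp
  then have "?g 1 = ?g 0" using DERIV_isconst_all[of ?g 1 0] by blast
  then show ?thesis by simp
qed

text \<open>A continuous function with finite range on a connected space is constant.\<close>

lemma continuous_sign_constant:
  fixes g :: "'a::real_normed_vector \<Rightarrow> real"
  assumes "continuous_on UNIV g" "\<And>p. (g p)^2 = 1"
  shows "g p = g q"
proof -
  have "range g \<subseteq> {1, -1}" using assms(2) by (auto simp: power2_eq_1_iff)
  then have "finite (range g)" by (rule finite_subset) simp
  with assms(1) have "g constant_on UNIV"
    using continuous_finite_range_constant[OF connected_UNIV] by blast
  then show ?thesis by (auto simp: constant_on_def)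
qed

text \<open>On \<open>\<vv>\<close> the metric has radical spanned by \<open>v\<close>, on \<open>\<zz>\<close> it has radical
  spanned by \<open>u\<close>. An isometry respecting the splitting preserves both radicals, and the
  remaining orthogonality relations make its differential diagonal in the frame.\<close>

lemma I_spl_differential:
  assumes "eps \<noteq> 0" "epsbar \<noteq> 0" "f \<in> I_spl eps epsbar"
  obtains a s t where "a \<noteq> 0" "s^2 = 1" "t^2 = 1"
    "\<And>h. frechet_derivative f (at p) h = vector [a * h$1, s * h$2,
        f p $ 1 * s * h$2 + t * (h$3 - p$1 * h$2), h$4 / a]"
proof -
  let ?D = "frechet_derivative f (at p)"
  define V where "V = ?D (frame_v p)"
  define E where "E = ?D (frame_e p)"
  define Z where "Z = ?D (frame_z p)"
  define U where "U = ?D (frame_u p)"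
  have im: "?D ` zN p = zN (f p)" "?D ` vN p = vN (f p)"
    and m: "metric eps epsbar (f p) (?D a) (?D b) = metric eps epsbar p a b" for a b
    using assms(3) by (auto simp: I_spl_def isometries_def)
  have "frame_v p \<in> vN p" "frame_e p \<in> vN p" "frame_z p \<in> zN p" "frame_u p \<in> zN p"
    unfolding vN_def zN_def by (simp_all add: span_base)
  then have "V \<in> vN (f p)" "E \<in> vN (f p)" "Z \<in> zN (f p)" "U \<in> zN (f p)"
    unfolding im[symmetric] V_def E_def Z_def U_def by (simp_all only: imageI)
  then have c: "V$3 = f p $ 1 * V$2" "V$4 = 0" "E$3 = f p $ 1 * E$2" "E$4 = 0"
    "Z$1 = 0" "Z$2 = 0" "U$1 = 0" "U$2 = 0"
    by (simp_all add: vN_eq zN_eq)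
  note mm = m[of "frame_v p" "frame_v p", unfolded metric_frame, folded V_def]
    m[of "frame_u p" "frame_u p", unfolded metric_frame, folded U_def]
    m[of "frame_e p" "frame_e p", unfolded metric_frame, folded E_def]
    m[of "frame_z p" "frame_z p", unfolded metric_frame, folded Z_def]
    m[of "frame_v p" "frame_u p", unfolded metric_frame, folded V_def U_def]
    m[of "frame_e p" "frame_u p", unfolded metric_frame, folded E_def U_def]
    m[of "frame_v p" "frame_z p", unfolded metric_frame, folded V_def Z_def]
  \<comment> \<open>The squared lengths of \<open>V\<close>, \<open>U\<close>, \<open>E\<close>,
    \<open>Z\<close> reduce to \<open>epsbar * (V$2)^2\<close>, \<open>eps * (U$3)^2\<close>,
    \<open>epsbar * (E$2)^2\<close>, \<open>eps * (Z$3)^2\<close>.\<close>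
  have V2: "V$2 = 0" and U3: "U$3 = 0" and E2: "(E$2)^2 = 1" and Z3: "(Z$3)^2 = 1"
    using mm(1-4) assms(1,2) by (simp_all add: metric_def frame_coords_def c power2_eq_square)
  have VU: "V$1 * U$4 = 1"
    using mm(5) by (simp add: metric_def frame_coords_def c V2)
  then have V1: "V$1 \<noteq> 0" and "U$4 \<noteq> 0" by auto
  \<comment> \<open>Orthogonality of e and u reads \<open>E$1 * U$4 = 0\<close>; that of v and z
    reads \<open>V$1 * Z$4 = 0\<close>.\<close>
  then have E1: "E$1 = 0" and Z4: "Z$4 = 0"
    using mm(6,7) by (simp_all add: metric_def frame_coords_def c V2 U3)
  have U4: "U$4 = 1 / V$1" using VU V1 by (simp add: field_simps)
  have "f differentiable (at p)"
    using assms(3) smooth_map_has_derivative[of f]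
    by (auto simp: I_spl_def isometries_def diffeo_def differentiable_def)
  then have "linear ?D" by (simp add: linear_frechet_derivative)
  then have D: "?D h = frame_coords p h $ 1 *\<^sub>R V + frame_coords p h $ 2 *\<^sub>R E
     + frame_coords p h $ 3 *\<^sub>R Z + frame_coords p h $ 4 *\<^sub>R U" for h
    by (subst frame_coords[of h p])
      (simp only: linear_add linear_cmul V_def E_def Z_def U_def)
  show thesis
  proof (rule that[OF V1 E2 Z3])
    show "?D h = vector [V$1 * h$1, E$2 * h$2,
        f p $ 1 * E$2 * h$2 + Z$3 * (h$3 - p$1 * h$2), h$4 / V$1]" for h
      unfolding D by (simp add: vec_eq_iff forall_4 frame_coords_def c V2 U3 E1 Z4 U4 algebra_simps)
  qed
qed

text \<open>Below, \<open>g = f\<^sub>3 \<mp> z\<close> depends on \<open>y\<close> alone, while its derivative \<open>m = \<plusminus>f\<^sub>1 \<mp> x\<close> in \<open>y\<close>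
  depends on \<open>x\<close> alone. Hence \<open>m\<close> is constant, which makes \<open>f\<^sub>1\<close> affine.\<close>

lemma I_spl_classification:
  assumes "eps \<noteq> 0" "epsbar \<noteq> 0" "f \<in> I_spl eps epsbar"
  obtains s t where "s^2 = 1" "t^2 = 1" "f = N4_mult (f 0) \<circ> diag_map s t"
proof -
  let ?D = "\<lambda>p. frechet_derivative f (at p)"
  have sm: "smooth_map f" using assms(3) by (simp add: I_spl_def isometries_def diffeo_def)
  note der = smooth_map_has_derivative[OF sm]
  have "\<forall>p. \<exists>a s t. a \<noteq> 0 \<and> s^2 = 1 \<and> t^2 = 1 \<and> (\<forall>h. ?D p h = vector [a * h$1, s * h$2,
        f p $ 1 * s * h$2 + t * (h$3 - p$1 * h$2), h$4 / a])"
    using I_spl_differential[OF assms] by metis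
  then obtain a S T where a: "\<And>p. a p \<noteq> 0" and S2: "\<And>p. (S p)^2 = 1" and T2: "\<And>p. (T p)^2 = 1"
    and D: "\<And>p h. ?D p h = vector [a p * h$1, S p * h$2,
        f p $ 1 * S p * h$2 + T p * (h$3 - p$1 * h$2), h$4 / a p]" by metis
  have cont: "continuous_on UNIV (\<lambda>p. ?D p h $ i)" for h i
  proof -
    have "Ck_map (Suc 0) f" using sm by (simp only: smooth_map_def)
    then show ?thesis by (auto intro!: continuous_intros)
  qed
  define s where "s = S 0"
  define t where "t = T 0"
  \<comment> \<open>\<open>S p\<close> and \<open>T p\<close> are diagonal entries of the
    differential in the coordinate basis, hence continuous in \<open>p\<close> and of constant
    sign.\<close>
  have S: "S p = s" for p
    unfolding s_def
    using continuous_sign_constant[of S p 0] cont[of "axis 2 1" 2] S2 by (simp add: D)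
  have T: "T p = t" for p
    unfolding t_def
    using continuous_sign_constant[of T p 0] cont[of "axis 3 1" 3] T2 by (simp add: D)
  have s: "s * s = 1" and t: "t * t = 1"
    using S2 T2 by (simp_all add: s_def t_def power2_eq_square)
  note [derivative_intros] = bounded_linear.has_derivative[OF bounded_linear_vec_nth]
  have d: "((\<lambda>p. f p $ i - c * p $ j) has_derivative (\<lambda>h. ?D p h $ i - c * h $ j)) (at p)" for i j p c
    by (intro derivative_intros der)
  have zero: "f p $ i - c * p $ j = f 0 $ i"
    if "\<And>p h. ?D p h $ i = c * h $ j" for i j c p
  proof -
    have "f (0 + p) $ i - c * (0 + p) $ j = f 0 $ i - c * 0 $ j"
      by (rule constant_along_line[OF d]) (simp add: that)
    then show ?thesis by simp
  qed
  have f2: "f p $ 2 - s * p $ 2 = f 0 $ 2" for p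
    by (rule zero) (simp add: D S)
  define g where "g p = f p $ 3 - t * p $ 3" for p
  define m where "m p = s * f p $ 1 - t * p $ 1" for p
  have dg: "(g has_derivative (\<lambda>h. m p * h $ 2)) (at p)" for p
  proof -
    have "(\<lambda>h. ?D p h $ 3 - t * h $ 3) = (\<lambda>h. m p * h $ 2)"
      by (simp add: fun_eq_iff D S T m_def algebra_simps)
    then show ?thesis using d[of 3 t 3 p] by (simp add: g_def[abs_def])
  qed
  have "m p = m 0" for p
  proof -
    let ?x = "p $ 1 *\<^sub>R axis 1 1 :: real^4" and ?y = "axis 2 1 :: real^4"
    have dm: "(m has_derivative (\<lambda>h. s * ?D p h $ 1 - t * h $ 1)) (at p)" for p
      unfolding m_def[abs_def] by (intro derivative_intros der)
    have "m p = m (?x + (p - ?x))" by simp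
    \<comment> \<open>The displacement \<open>p - ?x\<close> has no x-component, and the derivative
      of \<open>m\<close> sees only \<open>h $ 1\<close>.\<close>
    also have "\<dots> = m ?x"
      by (rule constant_along_line[OF dm]) (simp add: D)
    also have "m ?x = m 0"
    proof -
      \<comment> \<open>Shifting by \<open>?x\<close> does not change \<open>g\<close>, so its
        y-derivatives at \<open>?x\<close> and at \<open>0\<close> agree; these are
        \<open>m ?x\<close> and \<open>m 0\<close>.\<close>
      have "g (0 + r *\<^sub>R ?y) = g (?x + r *\<^sub>R ?y)" for r
        using constant_along_line[OF dg, of ?x "r *\<^sub>R ?y"] by (simp add: add.commute)
      moreover have "((\<lambda>r. g (q + r *\<^sub>R ?y)) has_real_derivative m q) (at 0)" for q
        using DERIV_along_line[OF dg, of q ?y 0] by simp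
      ultimately show ?thesis by (metis (no_types, lifting) DERIV_unique ext)
    qed
    finally show ?thesis .
  qed
  then have m: "s * f p $ 1 - t * p $ 1 = s * f 0 $ 1" for p
    by (simp add: m_def)
  have f1: "f p $ 1 = f 0 $ 1 + s * t * p $ 1" for p
  proof -
    have "s * (s * f p $ 1) = s * (s * f 0 $ 1 + t * p $ 1)" using m[of p] by simp
    then show ?thesis using s by (simp add: distrib_left flip: mult.assoc)
  qed
  have f3: "g p = g 0 + s * f 0 $ 1 * p $ 2" for p
  proof -
    have "((\<lambda>p. g p - s * f 0 $ 1 * p $ 2) has_derivative
        (\<lambda>h. m p * h $ 2 - s * f 0 $ 1 * h $ 2)) (at p)" for p
      by (intro derivative_intros dg)
    from constant_along_line[OF this, of p 0] m show ?thesis by (simp add: m_def)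
  qed
  \<comment> \<open>The free factor \<open>a p\<close> is the x-derivative of the first component,
    now known to be affine with slope \<open>s * t\<close>.\<close>
  have a_eq: "a p = s * t" for p
  proof -
    have "((\<lambda>p. f p $ 1) has_derivative (\<lambda>h. s * t * h $ 1)) (at p)"
      by (subst fun_eq_iff[THEN iffD2, OF allI, OF f1]) (auto intro!: derivative_eq_intros)
    moreover have "((\<lambda>p. f p $ 1) has_derivative (\<lambda>h. ?D p h $ 1)) (at p)"
      by (intro derivative_intros der)
    ultimately have "(\<lambda>h. s * t * h $ 1) = (\<lambda>h. ?D p h $ 1)" by (rule has_derivative_unique)
    from fun_cong[OF this, of "axis 1 1"] show ?thesis by (simp add: D)
  qed
  have f4: "f p $ 4 - s * t * p $ 4 = f 0 $ 4" for p
  proof (rule zero)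
    have "s * t * (s * t) = s * s * (t * t)" by (simp only: mult_ac)
    then have st: "s * t * (s * t) = 1" using s t by simp
    \<comment> \<open>Since \<open>s * t\<close> is its own reciprocal, the entry
      \<open>h$4 / a p\<close> has the linear form that \<open>zero\<close> requires.\<close>
    have "r / (s * t) = s * t * r" for r
    proof -
      have "r = s * t * (s * t) * r" using st by simp
      also have "\<dots> = s * t * r * (s * t)" by (simp only: mult_ac)
      finally have "r = s * t * r * (s * t)" .
      moreover have "s * t \<noteq> 0" using st by auto
      ultimately show ?thesis using nonzero_divide_eq_eq by blast
    qed
    then show "?D p h $ 4 = s * t * h $ 4" for p h by (simp only: D a_eq vec4_nth)
  qed
  \<comment> \<open>The term \<open>s * f 0 $ 1 * p $ 2\<close> of \<open>f3\<close> is the twist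
    that left multiplication by \<open>f 0\<close> adds to the third coordinate.\<close>
  have "f p = (N4_mult (f 0) \<circ> diag_map s t) p" for p
    using f1[of p] f2[of p] f3[of p] f4[of p]
    by (simp add: vec_eq_iff forall_4 N4_mult_def diag_map_def g_def algebra_simps)
  then have "f = N4_mult (f 0) \<circ> diag_map s t" by (rule ext)
  moreover have "s^2 = 1" "t^2 = 1" using S2 T2 by (simp_all add: s_def t_def)
  ultimately show thesis using that by blast
qed

lemma I_spl_subset_I_aut:
  assumes "eps \<noteq> 0" "epsbar \<noteq> 0" shows "I_spl eps epsbar \<subseteq> I_aut eps epsbar"
proof
  fix f assume "f \<in> I_spl eps epsbar"
  then obtain s t where "s^2 = 1" "t^2 = 1" "f = N4_mult (f 0) \<circ> diag_map s t"
    using I_spl_classification[OF assms] by metis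
  then show "f \<in> I_aut eps epsbar"
    unfolding I_aut_def using diag_map_O_N4 by blast
qed

section \<open>The flow\<close>

text \<open>The vector field is nilpotent as a derivation of the coordinate functions, so the exponential series of
  its flow stops at the quadratic term.\<close>

definition killing_flow :: "real \<Rightarrow> real \<Rightarrow> real \<Rightarrow> real \<Rightarrow> real \<Rightarrow> real^4 \<Rightarrow> real^4" where
  "killing_flow eps epsbar C2 C3 t p = (let X = killing_field eps epsbar C2 C3 p in
     p + t *\<^sub>R X + (t^2 / 2 * (epsbar * C3 * X$2 + C2 * X$3)) *\<^sub>R axis 4 1)"

lemma killing_flow_nth:
  "killing_flow eps epsbar C2 C3 t p $ 1 = p$1"
  "killing_flow eps epsbar C2 C3 t p $ 2 = p$2 - t * (epsbar * C2 / 2 * (p$1)^2 + C3 * p$1)"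
  "killing_flow eps epsbar C2 C3 t p $ 3 =
     p$3 - t * (epsbar * C2 / 3 * (p$1)^3 + C3 / 2 * (p$1)^2 + eps * C2 * p$1)"
  "killing_flow eps epsbar C2 C3 t p $ 4 = p$4 + t * (epsbar * C3 * p$2 + C2 * p$3)
     - t^2 / 2 * (epsbar * C3 * (epsbar * C2 / 2 * (p$1)^2 + C3 * p$1)
       + C2 * (epsbar * C2 / 3 * (p$1)^3 + C3 / 2 * (p$1)^2 + eps * C2 * p$1))"
  by (simp_all add: killing_flow_def Let_def killing_field_nth field_simps)

lemma is_flow_killing_flow:
  "is_flow (killing_field eps epsbar C2 C3) (killing_flow eps epsbar C2 C3)"
  unfolding is_flow_def has_vector_derivative_vec4_iff forall_4 killing_field_nth
  by (auto simp: killing_flow_nth vec_eq_iff forall_4 algebra_simps intro!: derivative_eq_intros)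

text \<open>Uniqueness of the flow reduces every claim about it to the explicit polynomial
  formula.\<close>

lemma is_flow_imp_killing_flow:
  "is_flow (killing_field eps epsbar C2 C3) \<Phi> \<Longrightarrow> \<Phi> = killing_flow eps epsbar C2 C3"
  using killing_field_flow_ex1 is_flow_killing_flow by blast

lemma killing_flow_add:
  "killing_flow eps epsbar C2 C3 (s + t)
    = killing_flow eps epsbar C2 C3 s \<circ> killing_flow eps epsbar C2 C3 t"
  by (simp add: fun_eq_iff vec_eq_iff forall_4 killing_flow_nth algebra_simps add_divide_distrib
      diff_divide_distrib power2_eq_square power3_eq_cube)

lemma killing_flow_zero: "killing_flow eps epsbar C2 C3 0 = id"
  by (simp add: fun_eq_iff vec_eq_iff forall_4 killing_flow_nth)

lemma smooth_killing_flow: "smooth_map (killing_flow eps epsbar C2 C3 t)"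
proof -
  let ?X = "killing_field eps epsbar C2 C3"
  have id: "Ck_map k (\<lambda>p. p)" for k
    by (intro Ck_map_linear bounded_linear_ident)
  \<comment> \<open>The polynomial field is spelled out as a sum of constant multiples of iterated
    products, the shape to which the closure rules for \<open>Ck_map\<close> apply.\<close>
  have "?X = (\<lambda>p.
      (- (epsbar * C2 / 2)) *\<^sub>R (p$1 *\<^sub>R (p$1 *\<^sub>R axis 2 1)) + (- C3) *\<^sub>R (p$1 *\<^sub>R axis 2 1)
      + (- (epsbar * C2 / 3)) *\<^sub>R (p$1 *\<^sub>R (p$1 *\<^sub>R (p$1 *\<^sub>R axis 3 1)))
      + (- (C3 / 2)) *\<^sub>R (p$1 *\<^sub>R (p$1 *\<^sub>R axis 3 1)) + (- (eps * C2)) *\<^sub>R (p$1 *\<^sub>R axis 3 1)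
      + (epsbar * C3) *\<^sub>R (p$2 *\<^sub>R axis 4 1) + C2 *\<^sub>R (p$3 *\<^sub>R axis 4 1))"
    by (simp add: fun_eq_iff vec_eq_iff forall_4 killing_field_nth power2_eq_square power3_eq_cube)
  then have X: "Ck_map k ?X" for k
    by (simp only:) (intro Ck_map_add Ck_map_cmult Ck_map_scaleR id Ck_map_const)
  have "killing_flow eps epsbar C2 C3 t = (\<lambda>p. p + t *\<^sub>R ?X p
      + ((t^2 / 2 * epsbar * C3) *\<^sub>R (?X p $ 2 *\<^sub>R axis 4 1)
      + (t^2 / 2 * C2) *\<^sub>R (?X p $ 3 *\<^sub>R axis 4 1)))"
    by (simp add: fun_eq_iff killing_flow_def Let_def distrib_left scaleR_add_left mult.assoc)
  then show ?thesis unfolding smooth_map_def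
    by (simp only:) (intro allI Ck_map_add Ck_map_cmult Ck_map_scaleR X id Ck_map_const)
qed

lemma killing_flow_has_derivative:
  "(killing_flow eps epsbar C2 C3 t has_derivative (\<lambda>h. vector [h$1,
     h$2 - t * (epsbar * C2 * p$1 + C3) * h$1,
     h$3 - t * (epsbar * C2 * (p$1)^2 + C3 * p$1 + eps * C2) * h$1,
     h$4 + t * (epsbar * C3 * h$2 + C2 * h$3)
       - t^2 / 2 * (epsbar * C3 * (epsbar * C2 * p$1 + C3)
         + C2 * (epsbar * C2 * (p$1)^2 + C3 * p$1 + eps * C2)) * h$1])) (at p)"
  unfolding killing_flow_def[abs_def] Let_def killing_field_nth killing_field_def
  by (auto intro!: derivative_eq_intros bounded_linear.has_derivative[OF bounded_linear_vec_nth]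
      simp: fun_eq_iff vec_eq_iff forall_4 field_simps power2_eq_square)

text \<open>In the metric, the terms linear in \<open>t\<close> from the e- and z-coefficients
  cancel against those of the w-component, and likewise the terms in \<open>t^2\<close>. The
  cancellation uses that \<open>eps\<close> and \<open>epsbar\<close> square to 1.\<close>

lemma killing_flow_isometry:
  assumes "eps \<in> {1, -1}" "epsbar \<in> {1, -1}"
  shows "killing_flow eps epsbar C2 C3 t \<in> isometries eps epsbar"
proof (rule isometriesI[OF _ killing_flow_has_derivative])
  show "diffeo (killing_flow eps epsbar C2 C3 t)"
    \<comment> \<open>By the group law, the flow at time \<open>- t\<close> is a smooth
      inverse.\<close>
    by (rule diffeoI[of _ "killing_flow eps epsbar C2 C3 (- t)"])
      (simp_all add: smooth_killing_flow killing_flow_zero flip: killing_flow_add)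
qed (use assms in \<open>auto simp: metric_def frame_coords_def killing_flow_nth field_simps
    power2_eq_square power3_eq_cube\<close>)

section \<open>Membership of the flow in the two subgroups\<close>

lemma killing_flow_in_I_aut_iff:
  assumes "eps \<in> {1, -1}" "epsbar \<in> {1, -1}"
  shows "range (killing_flow eps epsbar C2 C3) \<subseteq> I_aut eps epsbar \<longleftrightarrow> C2 = 0"
proof
  assume "C2 = 0"
  \<comment> \<open>The square in the third component has cross term
    \<open>- t * C3 * p$1 * q$1\<close>, exactly what the group law makes of the second component
    \<open>- t * C3 * q$1\<close>.\<close>
  then have "killing_flow eps epsbar C2 C3 t \<in> O_N4 eps epsbar" for t
    by (intro O_N4I killing_flow_isometry assms)
      (simp add: vec_eq_iff forall_4 killing_flow_nth N4_mult_def, simp add: field_simps power2_eq_square)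
  then show "range (killing_flow eps epsbar C2 C3) \<subseteq> I_aut eps epsbar"
    using O_N4_subset_I_aut by blast
next
  assume *: "range (killing_flow eps epsbar C2 C3) \<subseteq> I_aut eps epsbar"
  let ?F = "killing_flow eps epsbar C2 C3 1" and ?x = "axis 1 1 :: real^4"
  have "?F 0 = 0" by (simp add: vec_eq_iff forall_4 killing_flow_nth)
  then have "?F \<in> O_N4 eps epsbar" using * by (intro I_aut_fixing_zero) auto
  \<comment> \<open>Doubling x doubles the linear part of the y-component but quadruples the
    quadratic one, so additivity isolates \<open>epsbar * C2\<close>.\<close>
  from O_N4_hom[OF this, of ?x ?x]
  have "?F (N4_mult ?x ?x) $ 2 = N4_mult (?F ?x) (?F ?x) $ 2" by simp
  then have "epsbar * C2 = 0"
    by (auto simp: N4_mult_def killing_flow_nth)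
  then show "C2 = 0" using assms(2) by auto
qed

lemma killing_flow_in_I_spl_iff:
  assumes "eps \<in> {1, -1}" "epsbar \<in> {1, -1}"
  shows "range (killing_flow eps epsbar C2 C3) \<subseteq> I_spl eps epsbar \<longleftrightarrow> C2 = 0 \<and> C3 = 0"
proof
  assume "C2 = 0 \<and> C3 = 0"
  then have "killing_flow eps epsbar C2 C3 t = id" for t
    by (simp add: fun_eq_iff vec_eq_iff forall_4 killing_flow_nth)
  moreover have "id \<in> I_spl eps epsbar"
    using subgroup.one_closed[OF subgroup_I_spl] by (simp add: isometry_group_def)
  ultimately show "range (killing_flow eps epsbar C2 C3) \<subseteq> I_spl eps epsbar" by auto
next
  assume *: "range (killing_flow eps epsbar C2 C3) \<subseteq> I_spl eps epsbar"
  let ?F = "killing_flow eps epsbar C2 C3 1"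
  have "eps \<noteq> 0" "epsbar \<noteq> 0" "?F \<in> I_spl eps epsbar" using assms * by auto
  then obtain s t where "?F = N4_mult (?F 0) \<circ> diag_map s t"
    using I_spl_classification by metis
  then have F: "?F p $ 4 = (N4_mult (?F 0) (diag_map s t p)) $ 4" for p
    by (metis comp_apply)
  \<comment> \<open>At the unit points on the y- and z-axes the fourth component of the flow is
    \<open>epsbar * C3\<close> and \<open>C2\<close>, while that of the diagonal form
    vanishes.\<close>
  have "epsbar * C3 = 0" "C2 = 0"
    using F[of "axis 2 1"] F[of "axis 3 1"]
    by (simp_all add: N4_mult_def diag_map_def killing_flow_nth)
  then show "C2 = 0 \<and> C3 = 0" using assms(2) by auto
qed

theorem proposition5p19:
  fixes eps epsbar :: real
  assumes "eps \<in> {1, -1}" and "epsbar \<in> {1, -1}"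
  shows
    "(\<forall>C2 C3. \<forall>\<Phi>. is_flow (killing_field eps epsbar C2 C3) \<Phi> \<longrightarrow>
        (\<forall>t. \<Phi> t \<in> isometries eps epsbar \<and> \<Phi> t \<one>\<^bsub>N4\<^esub> = \<one>\<^bsub>N4\<^esub>)
        \<and> (\<forall>s t. \<Phi> (s + t) = \<Phi> s \<circ> \<Phi> t)
        \<and> (range \<Phi> \<subseteq> I_spl eps epsbar \<longleftrightarrow> C2 = 0 \<and> C3 = 0)
        \<and> (range \<Phi> \<subseteq> I_aut eps epsbar \<longleftrightarrow> C2 = 0))
     \<and> group (isometry_group eps epsbar)
     \<and> subgroup (I_aut eps epsbar) (isometry_group eps epsbar)
     \<and> I_aut eps epsbar \<noteq> carrier (isometry_group eps epsbar)
     \<and> subgroup (I_spl eps epsbar) (isometry_group eps epsbar\<lparr>carrier := I_aut eps epsbar\<rparr>)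
     \<and> I_spl eps epsbar \<noteq> I_aut eps epsbar"
proof (intro conjI allI impI)
  let ?G = "isometry_group eps epsbar"
  note flow = is_flow_imp_killing_flow
  {
    fix C2 C3 \<Phi> assume "is_flow (killing_field eps epsbar C2 C3) \<Phi>"
    then have \<Phi>: "\<Phi> = killing_flow eps epsbar C2 C3" by (rule flow)
    show "\<Phi> t \<in> isometries eps epsbar" for t
      unfolding \<Phi> by (rule killing_flow_isometry[OF assms])
    show "\<Phi> t \<one>\<^bsub>N4\<^esub> = \<one>\<^bsub>N4\<^esub>" for t
      by (simp add: \<Phi> N4_def vec_eq_iff forall_4 killing_flow_nth)
    show "\<Phi> (s + t) = \<Phi> s \<circ> \<Phi> t" for s t
      unfolding \<Phi> by (rule killing_flow_add)
    show "range \<Phi> \<subseteq> I_spl eps epsbar \<longleftrightarrow> C2 = 0 \<and> C3 = 0"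
      unfolding \<Phi> by (rule killing_flow_in_I_spl_iff[OF assms])
    show "range \<Phi> \<subseteq> I_aut eps epsbar \<longleftrightarrow> C2 = 0"
      unfolding \<Phi> by (rule killing_flow_in_I_aut_iff[OF assms])
  }
  show "group ?G" by (rule group_isometry_group)
  show "subgroup (I_aut eps epsbar) ?G" by (rule subgroup_I_aut)
  show "I_aut eps epsbar \<noteq> carrier ?G"
    \<comment> \<open>The flow with \<open>C2 = 1\<close> and \<open>C3 = 0\<close> consists of
      isometries but leaves \<open>I_aut\<close>.\<close>
    using killing_flow_in_I_aut_iff[OF assms, of 1 0] killing_flow_isometry[OF assms, of 1 0]
    by (auto simp: isometry_group_def)
  have "eps \<noteq> 0" "epsbar \<noteq> 0" using assms by auto
  then show "subgroup (I_spl eps epsbar) (?G\<lparr>carrier := I_aut eps epsbar\<rparr>)"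
    by (intro group.subgroup_incl group_isometry_group subgroup_I_spl subgroup_I_aut I_spl_subset_I_aut)
  show "I_spl eps epsbar \<noteq> I_aut eps epsbar"
    \<comment> \<open>The flow with \<open>C2 = 0\<close> and \<open>C3 = 1\<close> stays in
      \<open>I_aut\<close> but leaves \<open>I_spl\<close>.\<close>
    using killing_flow_in_I_aut_iff[OF assms, of 0 1] killing_flow_in_I_spl_iff[OF assms, of 0 1] by auto
qed

end
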